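(* Let $\mathcal{A}$ be an infinite alphabet. The shift map $\sigma:\Sigma_{\mathcal{A}}\to\Sigma_{\mathcal{A}}$ is continuous at all points in $\Sigma_{\mathcal{A}}\setminus\{\vec{0}\}$ and discontinuous at the point $\vec{0}$. In addition, if $x\in\Sigma_{\mathcal{A}}\setminus\{\vec{0}\}$, then there exists an open set $U\subseteq\Sigma_{\mathcal{A}}\setminus\{\vec{0}\}$ such that $x\in U$, $\sigma(U)$ is an open subset of $\Sigma_{\mathcal{A}}$, and $\sigma|_U:U\to\sigma(U)$ is a homeomorphism.
   Context: Let $\mathcal{A}$ be an infinite set and $\mathbb{N}=\{1,2,3,\ldots\}$. Put $\mathcal{A}^0=\{\vec{0}\}$ where $\vec{0}$ is the empty sequence, let $\mathcal{A}^k$ be the $k$-fold product for $k\in\mathbb{N}$, let $\mathcal{A}^{\mathbb{N}}=\mathcal{A}\times\mathcal{A}\times\cdots$, and let $\Sigma_{\mathcal{A}}:=\mathcal{A}^{\mathbb{N}}\sqcup\bigcup_{k=0}^\infty\mathcal{A}^k$. Topology: give $\mathcal{A}$ the discrete topology and let $\mathcal{A}_\infty=\mathcal{A}\cup\{\infty\}$ be its one-point compactification. Let $X_{\mathcal{A}}=\mathcal{A}_\infty\times\mathcal{A}_\infty\times\cdots$ with the product topology. Define $Q:X_{\mathcal{A}}\to\Sigma_{\mathcal{A}}$ by truncating a sequence just before the first occurrence of $\infty$: $Q(x_1x_2\ldots)=\vec{0}$ if $x_1=\infty$; $Q(x_1x_2\ldots)=x_1\ldots x_n$ if $x_{n+1}=\infty$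 and $x_i\neq\infty$ for $1\le i\le n$; and $Q(x_1x_2\ldots)=x_1x_2\ldots$ if no $x_i$ equals $\infty$. The space $\Sigma_{\mathcal{A}}$ has the quotient topology induced by $Q$. The shift map $\sigma:\Sigma_{\mathcal{A}}\to\Sigma_{\mathcal{A}}$ removes the first entry: $\sigma(x_1x_2x_3\ldots)=x_2x_3\ldots$ for infinite sequences, $\sigma(x_1\ldots x_n)=x_2\ldots x_n$ for $n\ge 2$, and $\sigma(x)=\vec{0}$ if $x\in\mathcal{A}^1\cup\{\vec{0}\}$. *)

theory Defs
  imports "HOL-Analysis.Analysis"
begin

text \<open>Sequences are indexed from \<open>0\<close>, so the entry \<open>x\<^sub>i\<close> of the mathematical text is \<open>x (i - 1)\<close>
  here. In a one-point compactification, \<^const>\<open>None\<close> plays the role of \<open>\<infinity>\<close>.\<close>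

datatype 'a fi_seq = FinSeq "'a list" | InfSeq "nat \<Rightarrow> 'a"

definition full_shift :: "'a set \<Rightarrow> 'a fi_seq set" where
  "full_shift A = {InfSeq x | x. \<forall>i. x i \<in> A} \<union> (\<Union>k. {FinSeq w | w. length w = k \<and> set w \<subseteq> A})"

abbreviation empty_seq :: "'a fi_seq" where
  "empty_seq \<equiv> FinSeq []"

definition X_topology :: "'a set \<Rightarrow> (nat \<Rightarrow> 'a option) topology" where
  "X_topology A = product_topology (\<lambda>_. Alexandroff_compactification (discrete_topology A)) UNIV"

definition Q :: "(nat \<Rightarrow> 'a option) \<Rightarrow> 'a fi_seq" where
  "Q x = (if \<exists>i. x i = None
          then FinSeq (map (\<lambda>i. the (x i)) [0..<(LEAST i. x i = None)])
          else InfSeq (\<lambda>i. the (x i)))"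

definition full_shift_topology :: "'a set \<Rightarrow> 'a fi_seq topology" where
  "full_shift_topology A = topology (\<lambda>U. U \<subseteq> full_shift A \<and>
     openin (X_topology A) {x \<in> topspace (X_topology A). Q x \<in> U})"

text \<open>Since \<^term>\<open>tl [] = []\<close>, sequences of length at most one are sent to the empty sequence.\<close>

fun shift_map :: "'a fi_seq \<Rightarrow> 'a fi_seq" where
  "shift_map (InfSeq x) = InfSeq (\<lambda>i. x (Suc i))"
| "shift_map (FinSeq w) = FinSeq (tl w)"

lemma openin_full_shift_topology:
  "openin (full_shift_topology A) U \<longleftrightarrow>
     U \<subseteq> full_shift A \<and> openin (X_topology A) {x \<in> topspace (X_topology A). Q x \<in> U}"
proof -
  let ?X = "X_topology A"
  have "istopology (\<lambda>U. U \<subseteq> full_shift A \<and> openin ?X {x \<in> topspace ?X. Q x \<in> U})"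
    unfolding istopology_def
  proof (intro conjI allI impI)
    fix S T
    assume *: "S \<subseteq> full_shift A \<and> openin ?X {x \<in> topspace ?X. Q x \<in> S}"
      "T \<subseteq> full_shift A \<and> openin ?X {x \<in> topspace ?X. Q x \<in> T}"
    then show "S \<inter> T \<subseteq> full_shift A" by blast
    have "{x \<in> topspace ?X. Q x \<in> S \<inter> T}
        = {x \<in> topspace ?X. Q x \<in> S} \<inter> {x \<in> topspace ?X. Q x \<in> T}" by blast
    with * show "openin ?X {x \<in> topspace ?X. Q x \<in> S \<inter> T}" by auto
  next
    fix K
    assume *: "\<forall>S\<in>K. S \<subseteq> full_shift A \<and> openin ?X {x \<in> topspace ?X. Q x \<in> S}"
    then show "\<Union>K \<subseteq> full_shift A" by blast
    have "{x \<in> topspace ?X. Q x \<in> \<Union>K} = (\<Union>S\<in>K. {x \<in> topspace ?X. Q x \<in> S})" by blast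
    with * show "openin ?X {x \<in> topspace ?X. Q x \<in> \<Union>K}" by auto
  qed
  then show ?thesis
    by (simp add: full_shift_topology_def)
qed

lemma topspace_X_topology:
  "x \<in> topspace (X_topology A) \<longleftrightarrow> (\<forall>i a. x i = Some a \<longrightarrow> a \<in> A)"
proof -
  have "x i \<in> insert None (Some ` A) \<longleftrightarrow> (\<forall>a. x i = Some a \<longrightarrow> a \<in> A)" for i
    by (cases "x i") auto
  then show ?thesis
    by (simp add: X_topology_def PiE_iff)
qed

lemma Q_in_full_shift:
  assumes "x \<in> topspace (X_topology A)"
  shows "Q x \<in> full_shift A"
proof -
  have *: "the (x i) \<in> A" if "x i \<noteq> None" for i
    using assms that by (auto simp: topspace_X_topology)
  have "the (x i) \<in> A" if "i < (LEAST i. x i = None)" for i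
    using *[OF not_less_Least[OF that]] .
  with * show ?thesis
    by (auto simp: full_shift_def Q_def)
qed

lemma topspace_full_shift_topology [simp]: "topspace (full_shift_topology A) = full_shift A"
proof
  show "topspace (full_shift_topology A) \<subseteq> full_shift A"
    by (metis openin_full_shift_topology openin_topspace)
  have "{x \<in> topspace (X_topology A). Q x \<in> full_shift A} = topspace (X_topology A)"
    by (auto simp: Q_in_full_shift)
  then have "openin (full_shift_topology A) (full_shift A)"
    by (simp add: openin_full_shift_topology)
  then show "full_shift A \<subseteq> topspace (full_shift_topology A)"
    by (rule openin_subset)
qed

lemma Q_surj: "Q ` topspace (X_topology A) = full_shift A"
proof
  show "Q ` topspace (X_topology A) \<subseteq> full_shift A"
    by (auto simp: Q_in_full_shift)
  show "full_shift A \<subseteq> Q ` topspace (X_topology A)"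
  proof
    fix y assume y: "y \<in> full_shift A"
    show "y \<in> Q ` topspace (X_topology A)"
    proof (cases y)
      case (InfSeq f)
      then have "y = Q (\<lambda>i. Some (f i))" "(\<lambda>i. Some (f i)) \<in> topspace (X_topology A)"
        using y by (auto simp: Q_def full_shift_def topspace_X_topology)
      then show ?thesis by blast
    next
      case (FinSeq w)
      define x where "x = (\<lambda>i. if i < length w then Some (w ! i) else None)"
      have "(LEAST i. x i = None) = length w"
        by (rule Least_equality) (auto simp: x_def split: if_splits)
      moreover have "x (length w) = None" by (simp add: x_def)
      ultimately have "Q x = FinSeq (map (\<lambda>i. the (x i)) [0..<length w])"
        by (auto simp: Q_def)
      also have "map (\<lambda>i. the (x i)) [0..<length w] = w"
        by (rule nth_equalityI) (auto simp: x_def)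
      finally have "Q x = y" using FinSeq by simp
      moreover have "x \<in> topspace (X_topology A)"
        using y FinSeq by (auto simp: x_def full_shift_def topspace_X_topology subset_iff)
      ultimately show ?thesis by blast
    qed
  qed
qed

lemma quotient_map_Q: "quotient_map (X_topology A) (full_shift_topology A) Q"
  by (auto simp: quotient_map_def Q_surj openin_full_shift_topology)

lemma shift_map_in_full_shift: "x \<in> full_shift A \<Longrightarrow> shift_map x \<in> full_shift A"
  by (cases x) (auto simp: full_shift_def subset_iff, metis list.sel(2) list.set_sel(2))

end

theory Submission
  imports Defs
begin

text \<open>The sequences starting with a fixed letter \<open>a\<close> form an open set, on which the shift is a
  homeomorphism onto the whole space, with prepending \<open>a\<close> as its inverse; these sets cover everything
  but the empty sequence. The shift is discontinuous at the empty sequence because, \<open>A\<close> being infinite,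
  every neighbourhood of it contains a word \<open>ab\<close> with \<open>b\<close> fixed, while the image \<open>b\<close> avoids a fixed
  neighbourhood of the empty sequence.\<close>

section \<open>Prepending a letter, and cylinders\<close>

fun fi_cons :: "'a \<Rightarrow> 'a fi_seq \<Rightarrow> 'a fi_seq" where
  "fi_cons a (FinSeq w) = FinSeq (a # w)"
| "fi_cons a (InfSeq x) = InfSeq (case_nat a x)"

text \<open>As an image under \<open>fi_cons a\<close>, rather than a condition on the first entry,
  the set comes with an inverse of the shift on it.\<close>

definition cylinder :: "'a set \<Rightarrow> 'a \<Rightarrow> 'a fi_seq set" where
  "cylinder A a = fi_cons a ` full_shift A"

lemma shift_map_fi_cons [simp]: "shift_map (fi_cons a y) = y"
  by (cases y) auto

lemma fi_cons_eq_iff [simp]: "fi_cons a x = fi_cons b y \<longleftrightarrow> a = b \<and> x = y"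
proof
  assume eq: "fi_cons a x = fi_cons b y"
  then have "x = y"
    by (metis shift_map_fi_cons)
  moreover have "a = b"
    using eq by (cases x; cases y) (auto dest: fun_cong[of _ _ 0])
  ultimately show "a = b \<and> x = y" by simp
qed simp

lemma fi_cons_not_empty [simp]: "fi_cons a x \<noteq> empty_seq" "empty_seq \<noteq> fi_cons a x"
  by (cases x; simp)+

lemma fi_cons_in_full_shift:
  assumes "a \<in> A" "y \<in> full_shift A"
  shows "fi_cons a y \<in> full_shift A"
  using assms by (cases y) (auto simp: full_shift_def split: nat.splits)

lemma cylinder_subset: "a \<in> A \<Longrightarrow> cylinder A a \<subseteq> full_shift A - {empty_seq}"
  by (auto simp: cylinder_def fi_cons_in_full_shift)

lemma full_shift_cylinder:
  assumes "x \<in> full_shift A - {empty_seq}"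
  obtains a where "a \<in> A" "x \<in> cylinder A a"
proof (cases x)
  case (FinSeq w)
  then obtain a v where "w = a # v"
    using assms by (cases w) auto
  then have "a \<in> A" "x = fi_cons a (FinSeq v)" "FinSeq v \<in> full_shift A"
    using assms FinSeq by (auto simp: full_shift_def)
  then show ?thesis
    using that unfolding cylinder_def by blast
next
  case (InfSeq f)
  then have "f 0 \<in> A" "x = fi_cons (f 0) (InfSeq (\<lambda>i. f (Suc i)))"
    "InfSeq (\<lambda>i. f (Suc i)) \<in> full_shift A"
    using assms by (auto simp: full_shift_def fun_eq_iff split: nat.splits)
  then show ?thesis
    using that unfolding cylinder_def by blast
qed

section \<open>Truncation seen from the first entry\<close>

lemma Q_rec:
  "Q x = (case x 0 of None \<Rightarrow> empty_seq | Some a \<Rightarrow> fi_cons a (Q (\<lambda>i. x (Suc i))))"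
proof (cases "x 0")
  case None
  then have "(LEAST i. x i = None) = 0" by simp
  with None show ?thesis by (auto simp: Q_def)
next
  case (Some a)
  show ?thesis
  proof (cases "\<exists>i. x i = None")
    case True
    then obtain n where n: "x n = None" by blast
    \<comment> \<open>Since \<open>x 0\<close> is a letter, the first \<open>None\<close> of
      \<open>x\<close> lies one place later than that of its tail.\<close>
    have L: "(LEAST i. x i = None) = Suc (LEAST i. x (Suc i) = None)"
      using n Some by (intro Least_Suc) auto
    have "\<exists>i. x (Suc i) = None"
      using n Some by (metis not0_implies_Suc option.distinct(1))
    with True show ?thesis
      by (simp add: Q_def L Some map_upt_Suc del: upt_Suc)
  next
    case False
    then show ?thesis
      by (auto simp: Q_def Some fun_eq_iff split: nat.splits)
  qed
qed

lemma Q_case_nat [simp]: "Q (case_nat (Some a) x) = fi_cons a (Q x)"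
  by (subst Q_rec) simp

lemma Q_case_nat_None [simp]: "Q (case_nat None x) = empty_seq"
  by (subst Q_rec) simp

text \<open>Only the first entry decides, by \<open>Q_rec\<close>. Openness and closedness of a
  cylinder thus reduce to those of the point \<open>Some a\<close> in the one-point
  compactification.\<close>

lemma Q_preimage_cylinder:
  assumes "a \<in> A"
  shows "{x \<in> topspace (X_topology A). Q x \<in> cylinder A a}
       = {x \<in> topspace (X_topology A). x 0 = Some a}"
proof -
  have "Q x \<in> cylinder A a \<longleftrightarrow> x 0 = Some a" if "x \<in> topspace (X_topology A)" for x
  proof -
    have "(\<lambda>i. x (Suc i)) \<in> topspace (X_topology A)"
      using that by (simp add: topspace_X_topology)
    from Q_in_full_shift[OF this] show ?thesis
      by (subst Q_rec) (auto simp: cylinder_def split: option.splits)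
  qed
  then show ?thesis by blast
qed

section \<open>Topology of cylinders, and the shift on them\<close>

lemma continuous_map_X_coordinate:
  "continuous_map (X_topology A) (Alexandroff_compactification (discrete_topology A)) (\<lambda>x. x i)"
  unfolding X_topology_def by (rule continuous_map_product_projection) simp

lemma openin_cylinder:
  assumes "a \<in> A"
  shows "openin (full_shift_topology A) (cylinder A a)"
proof -
  let ?K = "Alexandroff_compactification (discrete_topology A)"
  have "openin ?K {Some a}"
    using assms openin_Alexandroff_compactification_image_Some[of "discrete_topology A" "{a}"]
    by simp
  from openin_continuous_map_preimage[OF continuous_map_X_coordinate this, of 0]
  show ?thesis
    using cylinder_subset[OF assms] assms
    by (auto simp: openin_full_shift_topology Q_preimage_cylinder)
qed

text \<open>A single letter is compact, so its image is still closed once \<open>None\<close> is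
  added. This makes the complement of a cylinder a neighbourhood of \<open>empty_seq\<close>, as the
  discontinuity argument requires.\<close>

lemma closedin_cylinder:
  assumes "a \<in> A"
  shows "closedin (full_shift_topology A) (cylinder A a)"
proof -
  let ?K = "Alexandroff_compactification (discrete_topology A)"
  have "closedin ?K {Some a}"
    using assms closedin_Alexandroff_compactification_image_Some[of "discrete_topology A" "{a}"]
    by simp
  from closedin_continuous_map_preimage[OF continuous_map_X_coordinate this, of 0]
  have "closedin (X_topology A) {x \<in> topspace (X_topology A). Q x \<in> cylinder A a}"
    using assms by (simp add: Q_preimage_cylinder)
  then show ?thesis
    using cylinder_subset[OF assms] quotient_map_Q[of A]
    by (simp add: quotient_map_closedin) blast
qed

text \<open>By the universal property of the quotient it suffices to treat
  \<open>fi_cons a \<circ> Q\<close>. This equals \<open>Q \<circ> case_nat (Some a)\<close>, and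
  each coordinate of \<open>case_nat (Some a)\<close> is a constant or a projection.\<close>

lemma continuous_map_fi_cons:
  assumes "a \<in> A"
  shows "continuous_map (full_shift_topology A) (full_shift_topology A) (fi_cons a)"
proof (rule continuous_compose_quotient_map[OF quotient_map_Q])
  have "continuous_map (X_topology A) (Alexandroff_compactification (discrete_topology A))
          (\<lambda>x. case_nat (Some a) x k)" for k
    using assms by (cases k) (auto simp: continuous_map_X_coordinate)
  then have "continuous_map (X_topology A) (X_topology A) (case_nat (Some a))"
    by (subst (2) X_topology_def) (simp add: continuous_map_componentwise_UNIV)
  then have "continuous_map (X_topology A) (full_shift_topology A) (Q \<circ> case_nat (Some a))"
    using continuous_map_compose quotient_imp_continuous_map[OF quotient_map_Q] by blast
  then show "continuous_map (X_topology A) (full_shift_topology A) (fi_cons a \<circ> Q)"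
    by (simp add: o_def)
qed

text \<open>The shift lifts along \<open>Q\<close> to deletion of the first entry, but not on all of
  \<open>X_topology A\<close>: if \<open>x 0 = None\<close>, then \<open>Q x\<close> is empty
  whatever the tail is, whereas \<open>Q\<close> of the tail need not be. Hence the restriction to
  sequences that start with \<open>Some a\<close>.\<close>

lemma continuous_map_shift_map_cylinder:
  assumes "a \<in> A"
  shows "continuous_map (subtopology (full_shift_topology A) (cylinder A a))
           (full_shift_topology A) shift_map"
proof (rule continuous_compose_quotient_map)
  let ?P = "{x \<in> topspace (X_topology A). x 0 = Some a}"
  show "quotient_map (subtopology (X_topology A) ?P)
          (subtopology (full_shift_topology A) (cylinder A a)) Q"
    \<comment> \<open>A quotient map stays one when restricted to the full preimage of an open
      set.\<close>
    using quotient_map_restriction[OF quotient_map_Q Q_preimage_cylinder[OF assms]]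
      openin_cylinder[OF assms] by simp
  have "continuous_map (X_topology A) (X_topology A) (\<lambda>x i. x (Suc i))"
    by (subst (2) X_topology_def)
      (simp add: continuous_map_componentwise_UNIV continuous_map_X_coordinate)
  then have "continuous_map (X_topology A) (full_shift_topology A) (Q \<circ> (\<lambda>x i. x (Suc i)))"
    using continuous_map_compose quotient_imp_continuous_map[OF quotient_map_Q] by blast
  then have "continuous_map (subtopology (X_topology A) ?P) (full_shift_topology A)
               (Q \<circ> (\<lambda>x i. x (Suc i)))"
    by (rule continuous_map_from_subtopology)
  moreover have "(shift_map \<circ> Q) x = (Q \<circ> (\<lambda>x i. x (Suc i))) x"
    if "x \<in> topspace (subtopology (X_topology A) ?P)" for x
  proof -
    have "Q x = fi_cons a (Q (\<lambda>i. x (Suc i)))"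
      using that by (subst Q_rec) simp
    then show ?thesis by simp
  qed
  ultimately show "continuous_map (subtopology (X_topology A) ?P) (full_shift_topology A)
                     (shift_map \<circ> Q)"
    by (metis (no_types, lifting) continuous_map_eq)
qed

lemma shift_map_image_cylinder [simp]: "shift_map ` cylinder A a = full_shift A"
  by (simp add: cylinder_def image_image)

lemma homeomorphic_map_shift_map_cylinder:
  assumes "a \<in> A"
  shows "homeomorphic_map (subtopology (full_shift_topology A) (cylinder A a))
           (full_shift_topology A) shift_map"
  unfolding homeomorphic_map_maps homeomorphic_maps_def
proof (intro exI conjI)
  show "continuous_map (full_shift_topology A)
          (subtopology (full_shift_topology A) (cylinder A a)) (fi_cons a)"
    using continuous_map_fi_cons[OF assms]
    by (auto simp: continuous_map_in_subtopology cylinder_def)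
qed (use assms in \<open>auto simp: continuous_map_shift_map_cylinder, auto simp: cylinder_def\<close>)

text \<open>The cylinder around \<open>x\<close> is open, so the preimage of \<open>V\<close> inside
  it is open in the whole space as well.\<close>

lemma topcontinuous_at_shift_map:
  assumes "x \<in> full_shift A - {empty_seq}"
  shows "topcontinuous_at (full_shift_topology A) (full_shift_topology A) shift_map x"
proof -
  let ?T = "full_shift_topology A"
  obtain a where a: "a \<in> A" "x \<in> cylinder A a"
    using full_shift_cylinder[OF assms] .
  have "\<exists>U. openin ?T U \<and> x \<in> U \<and> (\<forall>y\<in>U. shift_map y \<in> V)"
    if V: "openin ?T V" "shift_map x \<in> V" for V
  proof (intro exI conjI)
    let ?U = "{y \<in> topspace (subtopology ?T (cylinder A a)). shift_map y \<in> V}"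
    show "openin ?T ?U"
      using openin_continuous_map_preimage[OF continuous_map_shift_map_cylinder[OF a(1)] V(1)]
        openin_cylinder[OF a(1)] by (rule openin_trans_full)
    show "x \<in> ?U"
      using assms a V by simp
  qed simp
  then show ?thesis
    using assms by (auto simp: topcontinuous_at_def shift_map_in_full_shift)
qed

section \<open>Discontinuity at the empty sequence\<close>

lemma not_topcontinuous_at_shift_map_empty:
  assumes "infinite A"
  shows "\<not> topcontinuous_at (full_shift_topology A) (full_shift_topology A) shift_map empty_seq"
proof
  let ?T = "full_shift_topology A" and ?K = "Alexandroff_compactification (discrete_topology A)"
  assume cont: "topcontinuous_at ?T ?T shift_map empty_seq"
  obtain b where b: "b \<in> A"
    using assms by (metis ex_in_conv finite.emptyI)
  \<comment> \<open>A letter \<open>b\<close> followed by \<open>None\<close> only. Then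
    \<open>Q (case_nat t y)\<close> is the word \<open>ab\<close> for \<open>t = Some a\<close> and
    \<open>empty_seq\<close> for \<open>t = None\<close>.\<close>
  define y where "y = case_nat (Some b) (\<lambda>_. None)"
  have "openin ?T (full_shift A - cylinder A b)"
    using closedin_cylinder[OF b] by (simp add: closedin_def)
  moreover have empty: "empty_seq \<in> full_shift A - cylinder A b"
    using cylinder_subset[OF b] by (auto simp: full_shift_def)
  ultimately obtain U where U: "openin ?T U" "empty_seq \<in> U"
      "\<forall>y\<in>U. shift_map y \<in> full_shift A - cylinder A b"
    using cont by (auto simp: topcontinuous_at_def)
  \<comment> \<open>Coordinate 0 is the identity in \<open>t\<close>; all others are
    constant.\<close>
  have "continuous_map ?K ?K (\<lambda>t. case_nat t y k)" for k
    using b by (cases k) (auto simp: y_def split: nat.splits)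
  then have "continuous_map ?K (X_topology A) (\<lambda>t. case_nat t y)"
    unfolding X_topology_def by (simp add: continuous_map_componentwise_UNIV)
  then have "continuous_map ?K ?T (Q \<circ> (\<lambda>t. case_nat t y))"
    using continuous_map_compose quotient_imp_continuous_map[OF quotient_map_Q] by blast
  from openin_continuous_map_preimage[OF this U(1)]
  have "openin ?K {t \<in> topspace ?K. Q (case_nat t y) \<in> U}" by simp
  moreover have "None \<in> {t \<in> topspace ?K. Q (case_nat t y) \<in> U}"
    using U by simp
  \<comment> \<open>Compact subsets of a discrete space are finite, so an open set containing
    \<open>None\<close> misses only finitely many letters.\<close>
  ultimately obtain C where C: "finite C"
    "{t \<in> topspace ?K. Q (case_nat t y) \<in> U} = insert None (Some ` (A - C))"
    by (auto simp: openin_Alexandroff_compactification compactin_discrete_topology)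
  obtain a where "a \<in> A - C"
    using assms C(1) by (metis Diff_infinite_finite ex_in_conv finite.emptyI)
  then have "Some a \<in> {t \<in> topspace ?K. Q (case_nat t y) \<in> U}"
    unfolding C by blast
  then have "shift_map (Q (case_nat (Some a) y)) \<notin> cylinder A b"
    using U by blast
  \<comment> \<open>\<open>Q y\<close> is the one-letter word \<open>b\<close>, which is also the
    shift of \<open>ab\<close>.\<close>
  moreover have "Q y \<in> cylinder A b"
    using Q_in_full_shift[of "\<lambda>_. None" A]
    by (simp add: y_def cylinder_def topspace_X_topology)
  ultimately show False by simp
qed

theorem proposition2p23:
  fixes A :: "'a set"
  assumes "infinite A"
  shows "(\<forall>x \<in> full_shift A - {empty_seq}.
            topcontinuous_at (full_shift_topology A) (full_shift_topology A) shift_map x)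
       \<and> \<not> topcontinuous_at (full_shift_topology A) (full_shift_topology A) shift_map empty_seq
       \<and> (\<forall>x \<in> full_shift A - {empty_seq}.
            \<exists>U. openin (full_shift_topology A) U \<and> U \<subseteq> full_shift A - {empty_seq} \<and> x \<in> U
              \<and> openin (full_shift_topology A) (shift_map ` U)
              \<and> homeomorphic_map (subtopology (full_shift_topology A) U)
                   (subtopology (full_shift_topology A) (shift_map ` U)) shift_map)"
proof (intro conjI ballI)
  let ?T = "full_shift_topology A"
  fix x assume "x \<in> full_shift A - {empty_seq}"
  then obtain a where a: "a \<in> A" "x \<in> cylinder A a"
    by (rule full_shift_cylinder)
  \<comment> \<open>The shift maps each cylinder onto the whole space, so the subtopology on the
    image is the full topology.\<close>
  have top: "openin ?T (full_shift A)" "subtopology ?T (full_shift A) = ?T"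
    using openin_topspace[of ?T] subtopology_topspace[of ?T] by simp_all
  show "\<exists>U. openin ?T U \<and> U \<subseteq> full_shift A - {empty_seq} \<and> x \<in> U
          \<and> openin ?T (shift_map ` U)
          \<and> homeomorphic_map (subtopology ?T U) (subtopology ?T (shift_map ` U)) shift_map"
    using a openin_cylinder[OF a(1)] cylinder_subset[OF a(1)]
      homeomorphic_map_shift_map_cylinder[OF a(1)]
    by (intro exI[of _ "cylinder A a"]) (simp add: top)
qed (use assms in \<open>simp_all add: topcontinuous_at_shift_map not_topcontinuous_at_shift_map_empty\<close>)

end
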